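(* Let $n\ge 3$ be an integer and let $j$ be an integer with $1\le j<n/2$. Put $\alpha=\pi/n$, $v=\cos\alpha$, $\theta=(n-2j)\pi/n\in(0,\pi)$, $C=\cos\theta$ and $$\lambda=\lambda(n,j)=\frac{v\,(2v^2-1-C)}{C-1}.$$ Let $\Omega$ be the regular $n$-gon in $\mathbb{R}^2$ with vertices $V_i=(\cos 2i\alpha,\sin 2i\alpha)$, $i\in\mathbb{Z}/n$; let side $i$ be the segment $V_iV_{i+1}$, let $M_i$ be its midpoint, let $\widehat M_i$ be the unit vector from the centre (the origin) towards $M_i$, and let $O_i=-\lambda\,\widehat M_i$. Equip side $i$ with the transversal line field given by the pencil of lines through the point $O_i$. Then this projective billiard is $n$-reflective, with primitive period $n$.
   Context: A projective billiard is a bounded domain $\Omega\subset\mathbb{R}^2$ together with a transversal line field assigning to each $p\in\partial\Omega$ (for a polygon: each $p$ interior to a side) a line $L(p)$ through $p$ not tangent to $\partial\Omega$. A ray arriving at $p$ is reflected into the ray such that the four lines (incoming line, outgoing line; tangent line, transversal line $L(p)$) through $p$ have cross ratio $-1$. When the transversal field on a side is the pencil through a point $O$ (the centre, required to lie off the line supporting the side), $L(p)$ is the line $pO$. An orbit is the sequence of successive impact points $p_1,p_2,\dots$ of a billiard trajectory in $\Omega$; it is $k$-periodic if the trajectory returns after $k$ reflections to the same point with the same oriented direction. $\Omega$ is $k$-reflective if there are a $k$-periodic orbit $(p_1,\dots,p_k)$ and an open set $U_1\times U_2\subset(\partial\Omega)^2$ containing $(p_1,p_2)$ such that every $(q_1,q_2)\in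 U_1\times U_2$ begins a $k$-periodic orbit. The period $k$ is primitive if the orbits are not $d$-periodic for a proper divisor $d$ of $k$. *)

theory Defs
  imports "HOL-Analysis.Analysis"
begin

type_synonym plane = "real \<times> real"


section \<open>Projective reflection\<close>

definition is_line :: "plane set \<Rightarrow> bool" where
  "is_line l \<longleftrightarrow> affine l \<and> aff_dim l = 1"

definition dir_line :: "plane \<Rightarrow> plane \<Rightarrow> plane set" where
  "dir_line p u = range (\<lambda>t. p + t *\<^sub>R u)"

definition det2 :: "plane \<Rightarrow> plane \<Rightarrow> real" where
  "det2 u w = fst u * snd w - snd u * fst w"

text \<open>The cross ratio of four lines through \<open>p\<close>, computed from direction vectors
  \<open>u1\<close>, \<dots>, \<open>u4\<close>; the value does not depend on their scaling.\<close>

definition has_cross_ratio ::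
  "plane \<Rightarrow> plane set \<Rightarrow> plane set \<Rightarrow> plane set \<Rightarrow> plane set \<Rightarrow> real \<Rightarrow> bool" where
  "has_cross_ratio p l1 l2 l3 l4 c \<longleftrightarrow>
     (\<exists>u1 u2 u3 u4. u1 \<noteq> 0 \<and> u2 \<noteq> 0 \<and> u3 \<noteq> 0 \<and> u4 \<noteq> 0 \<and>
        l1 = dir_line p u1 \<and> l2 = dir_line p u2 \<and> l3 = dir_line p u3 \<and> l4 = dir_line p u4 \<and>
        det2 u1 u4 * det2 u2 u3 \<noteq> 0 \<and>
        c = (det2 u1 u3 * det2 u2 u4) / (det2 u1 u4 * det2 u2 u3))"

text \<open>The cross ratio condition says that \<open>lout\<close> is the image of \<open>lin\<close> under the projective
  involution of the pencil at \<open>p\<close> fixing the tangent \<open>T\<close> and the transversal \<open>L\<close>.  When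
  \<open>lin = L\<close> the cross ratio is undefined; the involution then gives \<open>lout = L\<close>.\<close>

definition proj_reflects ::
  "plane \<Rightarrow> plane set \<Rightarrow> plane set \<Rightarrow> plane set \<Rightarrow> plane set \<Rightarrow> bool" where
  "proj_reflects p T L lin lout \<longleftrightarrow>
     has_cross_ratio p lin lout T L (-1) \<or> (lin = L \<and> lout = L)"


section \<open>Polygonal projective billiards\<close>

text \<open>\<open>pb_side B i\<close>, for \<open>i < pb_nsides B\<close>, is the pair of endpoints of a side, and
  \<open>pb_trans B i p\<close> is the transversal line at a point \<open>p\<close> interior to that side.\<close>

record proj_polygon =
  pb_domain :: "plane set"
  pb_nsides :: nat
  pb_side :: "nat \<Rightarrow> plane \<times> plane"
  pb_trans :: "nat \<Rightarrow> plane \<Rightarrow> plane set"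

definition side_segment :: "proj_polygon \<Rightarrow> nat \<Rightarrow> plane set" where
  "side_segment B i = closed_segment (fst (pb_side B i)) (snd (pb_side B i))"

definition side_interior :: "proj_polygon \<Rightarrow> nat \<Rightarrow> plane set" where
  "side_interior B i = open_segment (fst (pb_side B i)) (snd (pb_side B i))"

definition side_line :: "proj_polygon \<Rightarrow> nat \<Rightarrow> plane set" where
  "side_line B i = affine hull {fst (pb_side B i), snd (pb_side B i)}"

text \<open>The condition \<open>interior (closure D) = D\<close> excludes slits, so that the domain lies on only
  one side of each boundary segment.\<close>

definition projective_billiard :: "proj_polygon \<Rightarrow> bool" where
  "projective_billiard B \<longleftrightarrow>
     pb_domain B \<noteq> {} \<and> open (pb_domain B) \<and> connected (pb_domain B) \<and> bounded (pb_domain B) \<and>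
     interior (closure (pb_domain B)) = pb_domain B \<and>
     frontier (pb_domain B) = (\<Union>i<pb_nsides B. side_segment B i) \<and>
     (\<forall>i<pb_nsides B. fst (pb_side B i) \<noteq> snd (pb_side B i)) \<and>
     (\<forall>i<pb_nsides B. \<forall>k<pb_nsides B. i \<noteq> k \<longrightarrow> side_interior B i \<inter> side_segment B k = {}) \<and>
     (\<forall>i<pb_nsides B. \<forall>p\<in>side_interior B i.
        is_line (pb_trans B i p) \<and> p \<in> pb_trans B i p \<and> pb_trans B i p \<noteq> side_line B i)"

text \<open>Infinite sequences of impact points; the impacts are numbered from 0.  The orientation of
  the reflected ray is fixed by requiring the open segment to the next impact to lie in the
  domain.\<close>

definition billiard_orbit :: "proj_polygon \<Rightarrow> (nat \<Rightarrow> plane) \<Rightarrow> bool" where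
  "billiard_orbit B p \<longleftrightarrow>
     (\<exists>i<pb_nsides B. p 0 \<in> side_interior B i) \<and>
     (\<forall>m. p m \<noteq> p (Suc m) \<and> open_segment (p m) (p (Suc m)) \<subseteq> pb_domain B) \<and>
     (\<forall>m. \<exists>i<pb_nsides B. p (Suc m) \<in> side_interior B i \<and>
        proj_reflects (p (Suc m)) (side_line B i) (pb_trans B i (p (Suc m)))
          (affine hull {p m, p (Suc m)}) (affine hull {p (Suc m), p (Suc (Suc m))}))"

text \<open>Return to the same point with the same oriented direction; \<open>sgn\<close> normalises a vector to
  length 1.\<close>

definition periodic_orbit :: "nat \<Rightarrow> (nat \<Rightarrow> plane) \<Rightarrow> bool" where
  "periodic_orbit k p \<longleftrightarrow>
     0 < k \<and> p k = p 0 \<and> sgn (p (Suc k) - p k) = sgn (p 1 - p 0)"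

definition reflective_on :: "proj_polygon \<Rightarrow> nat \<Rightarrow> plane set \<Rightarrow> plane set \<Rightarrow> bool" where
  "reflective_on B k U1 U2 \<longleftrightarrow>
     openin (top_of_set (frontier (pb_domain B))) U1 \<and>
     openin (top_of_set (frontier (pb_domain B))) U2 \<and>
     (\<exists>p. billiard_orbit B p \<and> periodic_orbit k p \<and> p 0 \<in> U1 \<and> p 1 \<in> U2) \<and>
     (\<forall>q1\<in>U1. \<forall>q2\<in>U2. \<exists>q. billiard_orbit B q \<and> periodic_orbit k q \<and> q 0 = q1 \<and> q 1 = q2)"

definition k_reflective :: "proj_polygon \<Rightarrow> nat \<Rightarrow> bool" where
  "k_reflective B k \<longleftrightarrow> (\<exists>U1 U2. reflective_on B k U1 U2)"

definition k_reflective_primitive :: "proj_polygon \<Rightarrow> nat \<Rightarrow> bool" where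
  "k_reflective_primitive B k \<longleftrightarrow>
     (\<exists>U1 U2. reflective_on B k U1 U2 \<and>
        (\<forall>q d. billiard_orbit B q \<and> q 0 \<in> U1 \<and> q 1 \<in> U2 \<and> d dvd k \<and> d < k \<longrightarrow>
           \<not> periodic_orbit d q))"


section \<open>The regular polygon with its pencils\<close>

definition alpha :: "nat \<Rightarrow> real" where
  "alpha n = pi / real n"

definition theta :: "nat \<Rightarrow> nat \<Rightarrow> real" where
  "theta n j = (real n - 2 * real j) * pi / real n"

definition lambda_coeff :: "nat \<Rightarrow> nat \<Rightarrow> real" where
  "lambda_coeff n j =
     (let v = cos (alpha n); C = cos (theta n j) in v * (2 * v\<^sup>2 - 1 - C) / (C - 1))"

definition vert :: "nat \<Rightarrow> nat \<Rightarrow> plane" where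
  "vert n i = (cos (2 * real i * alpha n), sin (2 * real i * alpha n))"

definition side_mid :: "nat \<Rightarrow> nat \<Rightarrow> plane" where
  "side_mid n i = midpoint (vert n i) (vert n (Suc i))"

definition centre :: "nat \<Rightarrow> nat \<Rightarrow> nat \<Rightarrow> plane" where
  "centre n j i = - lambda_coeff n j *\<^sub>R sgn (side_mid n i)"

text \<open>No reduction of \<open>Suc i\<close> modulo \<open>n\<close> is needed, since \<open>vert n n = vert n 0\<close>.\<close>

definition regular_billiard :: "nat \<Rightarrow> nat \<Rightarrow> proj_polygon" where
  "regular_billiard n j =
     \<lparr> pb_domain = interior (convex hull (vert n ` {..<n})),
       pb_nsides = n,
       pb_side = (\<lambda>i. (vert n i, vert n (Suc i))),
       pb_trans = (\<lambda>i p. affine hull {p, centre n j i}) \<rparr>"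

end

theory Submission
  imports Defs
begin

text \<open>
  Write a point of side \<open>m\<close> as \<open>x\<^sub>m\<close>, with \<open>-1\<close> and \<open>1\<close> at the two ends, and let a
  trajectory visit the sides in cyclic order. With \<open>\<psi> = j\<pi>/n\<close>, so that
  \<open>1 - C = 2 cos\<^sup>2 \<psi>\<close>, the distance from the centre of a pencil to its side is
  \<open>v sin\<^sup>2 \<alpha> / cos\<^sup>2 \<psi>\<close>. Consecutive parameters \<open>x, y, z\<close> then obey the reflection law when
  \<open>(1 - y)(1 - x) - (1 + y)(1 + z) = - 4 cos\<^sup>2 \<psi> y (1 + z)(1 - x)\<close>
  (\<open>reflection_at_side\<close>).

  This second-order rational recurrence is the projection of a linear one. Put
  \<open>x\<^sub>m = g\<^sub>m / f\<^sub>m\<close> and normalise by \<open>f\<^sub>m - g\<^sub>m = f\<^sub>m\<^sub>+\<^sub>1 + g\<^sub>m\<^sub>+\<^sub>1\<close>; what remains is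
  \<open>f\<^sub>m\<^sub>+\<^sub>1 = f\<^sub>m\<^sub>-\<^sub>1 - 4 cos\<^sup>2 \<psi> g\<^sub>m\<close>. Eliminating \<open>g\<close> leaves a linear recurrence of
  order three with characteristic roots \<open>1\<close> and \<open>exp (\<plusminus> 2 i \<psi>)\<close>, all of them \<open>n\<close>-th roots of
  unity because \<open>n\<psi> = j\<pi>\<close>. Hence \<open>f\<close> is a constant plus a wave of frequency \<open>2\<psi>\<close>,
  \<open>g\<close> is such a wave without constant term, and both have period \<open>n\<close>
  (\<open>weight_moment_recurrences\<close>, \<open>periodic\<close>).

  The starting points \<open>x\<^sub>0, x\<^sub>1\<close> determine the coefficients. For \<open>x\<^sub>0 = x\<^sub>1 = 0\<close> the wave
  vanishes and the orbit runs through the midpoints of the sides. For nearby starting points the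
  wave is still small compared with the constant, so \<open>\<bar>g\<^sub>m\<bar> < f\<^sub>m\<close> for all \<open>m\<close> and all impacts stay
  interior to their sides (\<open>admissible_near_0\<close>). That gives an open set of \<open>n\<close>-periodic orbits.

  The period is primitive since these orbits meet the \<open>n\<close> sides one after the other, and since a
  billiard orbit in a convex domain is determined by its first two impacts
  (\<open>billiard_orbit_unique\<close>), so that there are no other orbits with the same start. The convex
  geometry needed is the description of the regular polygon by half-planes
  (\<open>ngon_eq_halfplanes\<close>).
\<close>


section \<open>Lines through a point and harmonic reflection\<close>

lemma affine_hull_eq_dir_line: "affine hull {p, q} = dir_line p (q - p)"
proof -
  have "u *\<^sub>R p + v *\<^sub>R q = p + v *\<^sub>R (q - p)" if "u + v = 1" for u v :: real
  proof -
    have u: "u = 1 - v" using that by simp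
    show ?thesis unfolding u by (simp add: algebra_simps)
  qed
  moreover have "\<exists>u v. p + t *\<^sub>R (q - p) = u *\<^sub>R p + v *\<^sub>R q \<and> u + v = 1" for t :: real
    by (rule exI[of _ "1 - t"], rule exI[of _ t]) (simp add: algebra_simps)
  ultimately show ?thesis
    unfolding affine_hull_2 dir_line_def by (auto simp: image_iff)
qed

lemma dir_line_change:
  assumes "q = p + a *\<^sub>R u" and "c \<noteq> 0"
  shows "dir_line q (c *\<^sub>R u) = dir_line p u"
proof -
  have "p + t *\<^sub>R u \<in> dir_line q (c *\<^sub>R u)" for t
  proof -
    have "p + t *\<^sub>R u = q + ((t - a) / c) *\<^sub>R (c *\<^sub>R u)"
      using assms by (simp add: scaleR_left_diff_distrib)
    then show ?thesis unfolding dir_line_def by blast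
  qed
  moreover have "q + t *\<^sub>R c *\<^sub>R u \<in> dir_line p u" for t
  proof -
    have "q + t *\<^sub>R c *\<^sub>R u = p + (a + t * c) *\<^sub>R u"
      using assms by (simp add: algebra_simps)
    then show ?thesis unfolding dir_line_def by blast
  qed
  ultimately show ?thesis by (auto simp: dir_line_def)
qed

lemma dir_line_eqD:
  assumes "dir_line p u = dir_line p w" and "u \<noteq> 0"
  obtains r where "r \<noteq> 0" "u = r *\<^sub>R w"
proof -
  have "p + 1 *\<^sub>R u \<in> dir_line p u" unfolding dir_line_def by blast
  then have "p + u \<in> dir_line p w" using assms(1) by simp
  then obtain r where "p + u = p + r *\<^sub>R w" unfolding dir_line_def by blast
  then have "u = r *\<^sub>R w" by simp
  moreover from this have "r \<noteq> 0" using assms(2) by auto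
  ultimately show thesis using that by blast
qed

lemma det2_zero_scaleR:
  assumes "det2 u w = 0" and "u \<noteq> 0" and "w \<noteq> 0"
  obtains r where "r \<noteq> 0" "u = r *\<^sub>R w"
proof -
  obtain a b where u: "u = (a, b)" by (cases u)
  obtain c d where w: "w = (c, d)" by (cases w)
  have eq: "a * d = b * c" using assms(1) by (simp add: u w det2_def)
  have "\<exists>r. a = r * c \<and> b = r * d"
  proof (cases "c = 0")
    case True
    then have "d \<noteq> 0" using assms(3) by (auto simp: w zero_prod_def)
    then show ?thesis using eq True by (intro exI[of _ "b / d"]) auto
  next
    case False
    then show ?thesis using eq by (intro exI[of _ "a / c"]) (auto simp: field_simps)
  qed
  then obtain r where "u = r *\<^sub>R w" by (auto simp: u w)
  then show thesis using that assms(2) by auto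
qed

lemma dir_line_parallel:
  assumes "det2 u w = 0" and "u \<noteq> 0" and "w \<noteq> 0"
  shows "dir_line p u = dir_line p w"
proof -
  obtain r where "r \<noteq> 0" "u = r *\<^sub>R w" using det2_zero_scaleR assms .
  then show ?thesis using dir_line_change[of p p 0 w r] by simp
qed

lemma det2_nonzero_vectors: "det2 u w \<noteq> 0 \<Longrightarrow> u \<noteq> 0 \<and> w \<noteq> 0"
  by (auto simp: det2_def)

lemma det2_scaleR: "det2 (r *\<^sub>R u) w = r * det2 u w" "det2 u (r *\<^sub>R w) = r * det2 u w"
  by (simp_all add: det2_def algebra_simps)

text \<open>Clearing denominators turns the condition "cross ratio \<open>-1\<close>" into an equation that
  is linear in each direction and that remains meaningful when the incoming line is the
  transversal line; in that case it forces the outgoing line to be the transversal line too.\<close>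

lemma proj_reflectsI:
  assumes "det2 u1 u3 \<noteq> 0" and "det2 u2 u3 \<noteq> 0" and "det2 u4 u3 \<noteq> 0"
    and harmonic: "det2 u1 u3 * det2 u2 u4 + det2 u1 u4 * det2 u2 u3 = 0"
  shows "proj_reflects p (dir_line p u3) (dir_line p u4) (dir_line p u1) (dir_line p u2)"
proof -
  have nz: "u1 \<noteq> 0" "u2 \<noteq> 0" "u3 \<noteq> 0" "u4 \<noteq> 0"
    using assms(1-3) det2_nonzero_vectors by blast+
  show ?thesis
  proof (cases "det2 u1 u4 = 0")
    case True
    then have "det2 u2 u4 = 0" using harmonic assms(1) by simp
    then show ?thesis
      unfolding proj_reflects_def using True nz dir_line_parallel by blast
  next
    case False
    have "has_cross_ratio p (dir_line p u1) (dir_line p u2) (dir_line p u3) (dir_line p u4) (-1)"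
      unfolding has_cross_ratio_def
    proof (intro exI conjI)
      show "det2 u1 u4 * det2 u2 u3 \<noteq> 0" using False assms(2) by simp
      then show "- 1 = det2 u1 u3 * det2 u2 u4 / (det2 u1 u4 * det2 u2 u3)"
        using harmonic by (simp add: field_simps)
    qed (use nz in auto)
    then show ?thesis by (simp add: proj_reflects_def)
  qed
qed

text \<open>The harmonic equation says that the outgoing direction is parallel to
  \<open>k = det2 u1 u3 *\<^sub>R u4 + det2 u1 u4 *\<^sub>R u3\<close>, a nonzero vector determined by the
  other three directions.\<close>

lemma proj_reflects_unique:
  assumes "proj_reflects p T L lin l" and "proj_reflects p T L lin l'"
  shows "l = l'"
proof -
  define H where "H u1 u2 u3 u4 \<longleftrightarrow>
      u1 \<noteq> 0 \<and> u2 \<noteq> 0 \<and> u3 \<noteq> 0 \<and> u4 \<noteq> 0 \<and> det2 u1 u4 \<noteq> 0 \<and> det2 u1 u3 \<noteq> 0 \<and>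
      det2 u1 u3 * det2 u2 u4 + det2 u1 u4 * det2 u2 u3 = 0" for u1 u2 u3 u4
  have H: "\<exists>u1 u2 u3 u4. lin = dir_line p u1 \<and> m = dir_line p u2 \<and> T = dir_line p u3 \<and>
      L = dir_line p u4 \<and> H u1 u2 u3 u4"
    if hcr: "has_cross_ratio p lin m T L (-1)" for m
  proof -
    obtain u1 u2 u3 u4 where u: "u1 \<noteq> 0" "u2 \<noteq> 0" "u3 \<noteq> 0" "u4 \<noteq> 0"
      "lin = dir_line p u1" "m = dir_line p u2" "T = dir_line p u3" "L = dir_line p u4"
      and d: "det2 u1 u4 * det2 u2 u3 \<noteq> 0"
      and c: "-1 = (det2 u1 u3 * det2 u2 u4) / (det2 u1 u4 * det2 u2 u3)"
      using hcr unfolding has_cross_ratio_def by (elim exE conjE)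
    have eq: "det2 u1 u3 * det2 u2 u4 = - (det2 u1 u4 * det2 u2 u3)"
      using c d by (metis eq_divide_eq mult_minus1)
    then have "det2 u1 u3 * det2 u2 u4 + det2 u1 u4 * det2 u2 u3 = 0" by linarith
    moreover have "det2 u1 u3 \<noteq> 0" using eq d by force
    ultimately have "H u1 u2 u3 u4" using u d unfolding H_def by simp
    then show ?thesis using u by blast
  qed
  have not_L: "lin \<noteq> L" if hcr: "has_cross_ratio p lin m T L (-1)" for m
  proof
    assume "lin = L"
    obtain u1 u2 u3 u4 where u: "lin = dir_line p u1" "L = dir_line p u4" "H u1 u2 u3 u4"
      using H[OF hcr] by blast
    then have "u1 \<noteq> 0" "det2 u1 u4 \<noteq> 0" by (auto simp: H_def)
    obtain r where "u1 = r *\<^sub>R u4"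
      using dir_line_eqD[of p u1 u4] u \<open>lin = L\<close> \<open>u1 \<noteq> 0\<close> by metis
    then show False using \<open>det2 u1 u4 \<noteq> 0\<close> by (simp add: det2_def)
  qed
  show ?thesis
  proof (cases "lin = L")
    case True
    then show ?thesis using assms not_L unfolding proj_reflects_def by blast
  next
    case False
    then have c: "has_cross_ratio p lin l T L (-1)" "has_cross_ratio p lin l' T L (-1)"
      using assms unfolding proj_reflects_def by blast+
    obtain u1 u2 u3 u4 where u: "lin = dir_line p u1" "l = dir_line p u2" "T = dir_line p u3"
      "L = dir_line p u4" and Hu: "H u1 u2 u3 u4"
      using H[OF c(1)] by blast
    obtain w1 w2 w3 w4 where w: "lin = dir_line p w1" "l' = dir_line p w2" "T = dir_line p w3"
      "L = dir_line p w4" and Hw: "H w1 w2 w3 w4"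
      using H[OF c(2)] by blast
    obtain r1 where r1: "r1 \<noteq> 0" "u1 = r1 *\<^sub>R w1"
      using dir_line_eqD[of p u1 w1] u w Hu unfolding H_def by metis
    obtain r3 where r3: "r3 \<noteq> 0" "u3 = r3 *\<^sub>R w3"
      using dir_line_eqD[of p u3 w3] u w Hu unfolding H_def by metis
    obtain r4 where r4: "r4 \<noteq> 0" "u4 = r4 *\<^sub>R w4"
      using dir_line_eqD[of p u4 w4] u w Hu unfolding H_def by metis
    define k where "k = det2 w1 w3 *\<^sub>R w4 + det2 w1 w4 *\<^sub>R w3"
    have det_k: "det2 z k = det2 w1 w3 * det2 z w4 + det2 w1 w4 * det2 z w3" for z
      by (simp add: k_def det2_def algebra_simps)
    have "det2 w1 k \<noteq> 0" using Hw by (simp add: det_k H_def)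
    then have "k \<noteq> 0" using det2_nonzero_vectors by blast
    have "det2 w2 k = 0" using Hw by (simp add: det_k H_def)
    have "(r1 * r3 * r4) * det2 u2 k = 0"
      using Hu by (simp add: det_k H_def r1 r3 r4 det2_scaleR algebra_simps)
    then have "det2 u2 k = 0" using r1 r3 r4 by simp
    have "dir_line p u2 = dir_line p k"
      using dir_line_parallel \<open>det2 u2 k = 0\<close> \<open>k \<noteq> 0\<close> Hu unfolding H_def by blast
    moreover have "dir_line p w2 = dir_line p k"
      using dir_line_parallel \<open>det2 w2 k = 0\<close> \<open>k \<noteq> 0\<close> Hw unfolding H_def by blast
    ultimately show ?thesis using u w by simp
  qed
qed


section \<open>Determinism of convex projective billiards\<close>

text \<open>A line that enters a convex set at \<open>P\<close> leaves it at one further point only: of two candidates on the same side of \<open>P\<close>, the nearer one would lie inside the set,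
  and two candidates on opposite sides would put \<open>P\<close> itself inside.\<close>

lemma convex_exit_point_unique:
  fixes P A B :: plane
  assumes D: "convex D" and "P \<notin> D" "A \<notin> D" "B \<notin> D" "P \<noteq> A" "P \<noteq> B"
    and PA: "open_segment P A \<subseteq> D" and PB: "open_segment P B \<subseteq> D"
    and line: "affine hull {P, A} = affine hull {P, B}"
  shows "A = B"
proof -
  have "dir_line P (B - P) = dir_line P (A - P)"
    using line by (simp add: affine_hull_eq_dir_line)
  then obtain t where t: "t \<noteq> 0" "B - P = t *\<^sub>R (A - P)"
    using dir_line_eqD[of P "B - P" "A - P"] \<open>P \<noteq> B\<close> by auto
  have B: "B = P + t *\<^sub>R (A - P)" using t(2) by (simp add: algebra_simps)
  consider "t = 1" | "0 < t" "t < 1" | "1 < t" | "t < 0" using t(1) by linarith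
  then show ?thesis
  proof cases
    case 1
    then show ?thesis using B by simp
  next
    case 2
    have "B = (1 - t) *\<^sub>R P + t *\<^sub>R A" using B by (simp add: algebra_simps)
    then have "B \<in> open_segment P A" using 2 \<open>P \<noteq> A\<close> by (auto simp: in_segment)
    then show ?thesis using PA \<open>B \<notin> D\<close> by blast
  next
    case 3
    have "A = P + (1 / t) *\<^sub>R (B - P)" using t by simp
    then have "A = (1 - 1 / t) *\<^sub>R P + (1 / t) *\<^sub>R B"
      by (simp add: algebra_simps)
    moreover have "0 < 1 / t" "1 / t < 1" using 3 by auto
    ultimately have "A \<in> open_segment P B" using \<open>P \<noteq> B\<close> unfolding in_segment by blast
    then show ?thesis using PB \<open>A \<notin> D\<close> by blast
  next
    case 4
    have "midpoint P A \<in> D" "midpoint P B \<in> D"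
      using PA PB \<open>P \<noteq> A\<close> \<open>P \<noteq> B\<close> by (auto simp: midpoint_in_open_segment)
    moreover have "0 \<le> - t / (1 - t)" "0 \<le> 1 / (1 - t)" "- t / (1 - t) + 1 / (1 - t) = 1"
      using 4 by (auto simp: divide_simps)
    ultimately have "(- t / (1 - t)) *\<^sub>R midpoint P A + (1 / (1 - t)) *\<^sub>R midpoint P B \<in> D"
      using convexD[OF D] by blast
    moreover have "(- t / (1 - t)) *\<^sub>R midpoint P A + (1 / (1 - t)) *\<^sub>R midpoint P B = P"
    proof -
      have "(- t) *\<^sub>R midpoint P A + midpoint P B = (1 - t) *\<^sub>R P"
        by (cases P; cases A) (simp add: B midpoint_def field_simps)
      then have "(1 / (1 - t)) *\<^sub>R ((- t) *\<^sub>R midpoint P A + midpoint P B) = P"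
        using 4 by simp
      then show ?thesis by (simp add: scaleR_right_distrib scaleR_right_diff_distrib)
    qed
    ultimately show ?thesis using \<open>P \<notin> D\<close> by simp
  qed
qed

text \<open>The reflected line is determined by the incoming one, and convexity leaves one exit
  point on it.\<close>

lemma billiard_orbit_unique:
  assumes B: "projective_billiard B" and conv: "convex (pb_domain B)"
    and p: "billiard_orbit B p" and q: "billiard_orbit B q"
    and init: "p 0 = q 0" "p 1 = q 1"
  shows "p = q"
proof -
  have op: "open (pb_domain B)"
    and fr: "frontier (pb_domain B) = (\<Union>i<pb_nsides B. side_segment B i)"
    and disj: "\<And>i k. \<lbrakk>i < pb_nsides B; k < pb_nsides B; i \<noteq> k\<rbrakk> \<Longrightarrow>
      side_interior B i \<inter> side_segment B k = {}"
    using B unfolding projective_billiard_def by simp_all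
  have int_seg: "side_interior B i \<subseteq> side_segment B i" for i
    unfolding side_interior_def side_segment_def by (rule segment_open_subset_closed)
  have off: "x \<notin> pb_domain B" if "i < pb_nsides B" "x \<in> side_interior B i" for x i
  proof -
    have "x \<in> frontier (pb_domain B)" using fr int_seg[of i] that by blast
    then show ?thesis using op by (simp add: frontier_def interior_open)
  qed
  have orb: "r m \<notin> pb_domain B" if "billiard_orbit B r" for r m
  proof -
    have "\<exists>i<pb_nsides B. r m \<in> side_interior B i"
      using that unfolding billiard_orbit_def by (cases m) auto
    then show ?thesis using off by blast
  qed
  have "p m = q m \<and> p (Suc m) = q (Suc m)" for m
  proof (induction m)
    case 0
    then show ?case using init by simp
  next
    case (Suc m)
    let ?P = "p (Suc m)"
    obtain i where i: "i < pb_nsides B" "?P \<in> side_interior B i"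
      "proj_reflects ?P (side_line B i) (pb_trans B i ?P)
          (affine hull {p m, ?P}) (affine hull {?P, p (Suc (Suc m))})"
      using p unfolding billiard_orbit_def by blast
    obtain k where k: "k < pb_nsides B" "?P \<in> side_interior B k"
      "proj_reflects ?P (side_line B k) (pb_trans B k ?P)
          (affine hull {p m, ?P}) (affine hull {?P, q (Suc (Suc m))})"
      using q Suc unfolding billiard_orbit_def by metis
    have "i = k"
      using disj[of i k] i(1,2) k(1,2) int_seg[of k] by auto
    then have "affine hull {?P, p (Suc (Suc m))} = affine hull {?P, q (Suc (Suc m))}"
      using proj_reflects_unique i(3) k(3) by metis
    moreover have "?P \<noteq> p (Suc (Suc m))" "open_segment ?P (p (Suc (Suc m))) \<subseteq> pb_domain B"
      using p unfolding billiard_orbit_def by simp_all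
    moreover have "?P \<noteq> q (Suc (Suc m))" "open_segment ?P (q (Suc (Suc m))) \<subseteq> pb_domain B"
      using q Suc unfolding billiard_orbit_def by simp_all
    ultimately have "p (Suc (Suc m)) = q (Suc (Suc m))"
      using convex_exit_point_unique[OF conv orb[OF p] orb[OF p] orb[OF q]] by simp
    then show ?case using Suc by simp
  qed
  then show ?thesis by blast
qed


section \<open>The regular polygon as an intersection of half-planes\<close>

locale regular_polygon =
  fixes n :: nat
  assumes three_sides: "3 \<le> n"
begin

abbreviation a :: real where "a \<equiv> alpha n"

definition nrm :: "nat \<Rightarrow> plane" where
  "nrm k = (cos ((2 * real k + 1) * a), sin ((2 * real k + 1) * a))"

definition tng :: "nat \<Rightarrow> plane" where
  "tng k = (- sin ((2 * real k + 1) * a), cos ((2 * real k + 1) * a))"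

text \<open>The affine parameter \<open>x\<close> runs from \<open>-1\<close> to \<open>1\<close> along side \<open>k\<close>; half a side has
  length \<open>sin a\<close>, and the sides lie at distance \<open>cos a\<close> from the origin.\<close>

definition side_pt :: "nat \<Rightarrow> real \<Rightarrow> plane" where
  "side_pt k x = cos a *\<^sub>R nrm k + (sin a * x) *\<^sub>R tng k"

lemma n_angle: "real n * a = pi"
  using three_sides by (simp add: alpha_def)

lemma angle_bounds: "0 < a" "a < pi / 2"
proof -
  show "0 < a" using three_sides by (simp add: alpha_def)
  have "3 * a \<le> real n * a" using three_sides \<open>0 < a\<close> by simp
  then show "a < pi / 2" using \<open>0 < a\<close> by (simp add: n_angle)
qed

lemma sin_pos: "0 < sin a" and cos_pos: "0 < cos a"
  using angle_bounds by (auto intro: sin_gt_zero cos_gt_zero)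

lemma cos_shift: "cos (y + 2 * pi * of_int q) = cos y"
  and sin_shift: "sin (y + 2 * pi * of_int q) = sin y" for y :: real and q :: int
  using cos_int_2pin[of q] sin_int_2pin[of q] by (simp_all add: cos_add sin_add)

lemma side_angle_mod:
  "(2 * real k + 1) * a = (2 * real (k mod n) + 1) * a + 2 * pi * of_int (int (k div n))"
proof -
  have "real k = real n * real (k div n) + real (k mod n)"
    by (metis mult_div_mod_eq of_nat_add of_nat_mult)
  then have "2 * real k * a = 2 * (real n * a) * real (k div n) + 2 * real (k mod n) * a"
    by (simp add: algebra_simps)
  then show ?thesis unfolding n_angle by (simp add: algebra_simps)
qed

lemma nrm_mod: "nrm (k mod n) = nrm k" and tng_mod: "tng (k mod n) = tng k"
  unfolding nrm_def tng_def side_angle_mod[of k] cos_shift sin_shift by simp_all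

lemma side_pt_mod: "side_pt (k mod n) x = side_pt k x"
  by (simp add: side_pt_def nrm_mod tng_mod)

lemma nrm_Suc: "nrm (Suc k) = cos (2 * a) *\<^sub>R nrm k + sin (2 * a) *\<^sub>R tng k"
  and tng_Suc: "tng (Suc k) = cos (2 * a) *\<^sub>R tng k - sin (2 * a) *\<^sub>R nrm k"
proof -
  define b where "b = (2 * real k + 1) * a"
  have "(2 * real (Suc k) + 1) * a = b + 2 * a"
    by (simp add: b_def algebra_simps)
  then have "nrm (Suc k) = (cos (b + 2 * a), sin (b + 2 * a))"
    "tng (Suc k) = (- sin (b + 2 * a), cos (b + 2 * a))"
    by (simp_all only: nrm_def tng_def)
  moreover have "nrm k = (cos b, sin b)" "tng k = (- sin b, cos b)"
    by (simp_all add: nrm_def tng_def b_def)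
  ultimately show "nrm (Suc k) = cos (2 * a) *\<^sub>R nrm k + sin (2 * a) *\<^sub>R tng k"
    "tng (Suc k) = cos (2 * a) *\<^sub>R tng k - sin (2 * a) *\<^sub>R nrm k"
    by (simp_all add: cos_add sin_add)
qed

lemma inner_frame [simp]:
  "nrm k \<bullet> nrm k = 1" "nrm k \<bullet> tng k = 0" "tng k \<bullet> nrm k = 0" "tng k \<bullet> tng k = 1"
  by (simp_all add: nrm_def tng_def flip: power2_eq_square)

lemma frame_expansion: "p = (nrm k \<bullet> p) *\<^sub>R nrm k + (tng k \<bullet> p) *\<^sub>R tng k"
proof -
  define c where "c = cos ((2 * real k + 1) * a)"
  define s where "s = sin ((2 * real k + 1) * a)"
  obtain u w where p: "p = (u, w)" by (cases p)
  have "c * c + s * s = 1"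
    unfolding c_def s_def by (simp flip: power2_eq_square)
  then have "u = (c * u + s * w) * c - (c * w - s * u) * s"
    "w = (c * u + s * w) * s + (c * w - s * u) * c"
    by algebra+
  moreover have "nrm k = (c, s)" "tng k = (- s, c)"
    by (simp_all add: nrm_def tng_def c_def s_def)
  ultimately show ?thesis by (simp add: p algebra_simps)
qed

lemma nrm_pred: "nrm k = cos (2 * a) *\<^sub>R nrm (Suc k) - sin (2 * a) *\<^sub>R tng (Suc k)"
  and tng_pred: "tng k = cos (2 * a) *\<^sub>R tng (Suc k) + sin (2 * a) *\<^sub>R nrm (Suc k)"
proof -
  have "w = (cos (2 * a) * cos (2 * a)) *\<^sub>R w + (sin (2 * a) * sin (2 * a)) *\<^sub>R w" for w :: plane
    using sin_cos_squared_add[of "2 * a"]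
    by (simp add: add.commute power2_eq_square flip: scaleR_left_distrib)
  from this[of "nrm k"] this[of "tng k"]
  show "nrm k = cos (2 * a) *\<^sub>R nrm (Suc k) - sin (2 * a) *\<^sub>R tng (Suc k)"
    "tng k = cos (2 * a) *\<^sub>R tng (Suc k) + sin (2 * a) *\<^sub>R nrm (Suc k)"
    unfolding nrm_Suc tng_Suc by (simp_all add: algebra_simps)
qed

lemma vert_eq_side_pt: "vert n k = side_pt k (-1)"
  and vert_Suc_eq_side_pt: "vert n (Suc k) = side_pt k 1"
proof -
  define b where "b = (2 * real k + 1) * a"
  have "2 * real k * a = b - a" "2 * real (Suc k) * a = b + a"
    by (simp_all add: b_def algebra_simps)
  moreover have "nrm k = (cos b, sin b)" "tng k = (- sin b, cos b)"
    by (simp_all add: nrm_def tng_def b_def)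
  ultimately show "vert n k = side_pt k (-1)" "vert n (Suc k) = side_pt k 1"
    by (simp_all add: vert_def side_pt_def cos_add sin_add cos_diff sin_diff)
qed

lemma side_pt_segment: "(1 - u) *\<^sub>R vert n k + u *\<^sub>R vert n (Suc k) = side_pt k (2 * u - 1)"
  unfolding vert_eq_side_pt[of k] vert_Suc_eq_side_pt
  by (cases "nrm k"; cases "tng k") (simp add: side_pt_def algebra_simps)

lemma side_pt_convex_comb:
  "side_pt k x = ((1 - x) / 2) *\<^sub>R vert n k + ((1 + x) / 2) *\<^sub>R vert n (Suc k)"
proof -
  have e: "1 - (1 + x) / 2 = (1 - x) / 2" "2 * ((1 + x) / 2) - 1 = x" by (simp_all add: field_simps)
  show ?thesis using side_pt_segment[of "(1 + x) / 2" k] unfolding e by (rule sym)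
qed

lemma vert_distinct: "vert n k \<noteq> vert n (Suc k)"
proof
  assume "vert n k = vert n (Suc k)"
  then have "tng k \<bullet> vert n k = tng k \<bullet> vert n (Suc k)" by simp
  then show False
    using sin_pos unfolding vert_eq_side_pt[of k] vert_Suc_eq_side_pt
    by (simp add: side_pt_def inner_right_distrib inner_diff_right)
qed

lemma nrm_side_pt_self [simp]: "nrm k \<bullet> side_pt k x = cos a"
  by (simp add: side_pt_def inner_right_distrib)

lemma side_closed_segment: "closed_segment (vert n k) (vert n (Suc k)) = side_pt k ` {-1..1}"
proof -
  have "x \<in> (\<lambda>u. 2 * u - 1) ` {0..1}" if "-1 \<le> x" "x \<le> 1" for x :: real
    using that by (intro image_eqI[of _ _ "(1 + x) / 2"]) (auto simp: field_simps)
  then have "(\<lambda>u. 2 * u - 1) ` {0..1} = {-1..1::real}" by auto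
  then show ?thesis
    unfolding closed_segment_image_interval side_pt_segment by (metis image_image)
qed

lemma side_open_segment: "open_segment (vert n k) (vert n (Suc k)) = side_pt k ` {-1<..<1}"
proof -
  have "x \<in> (\<lambda>u. 2 * u - 1) ` {0<..<1}" if "-1 < x" "x < 1" for x :: real
    using that by (intro image_eqI[of _ _ "(1 + x) / 2"]) (auto simp: field_simps)
  then have "(\<lambda>u. 2 * u - 1) ` {0<..<1} = {-1<..<1::real}" by auto
  then show ?thesis
    using vert_distinct[of k] unfolding open_segment_image_interval side_pt_segment
    by (metis image_image)
qed

text \<open>Among the odd multiples of \<open>pi / n\<close> in a full turn, the nearest to \<open>0\<close> modulo
  \<open>2 * pi\<close> are \<open>pi / n\<close> and \<open>- pi / n\<close>.\<close>

lemma cos_odd_multiple_le: "cos ((2 * of_int m + 1) * a) \<le> cos a" for m :: int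
proof -
  define r where "r = m mod int n"
  define y where "y = (2 * of_int r + 1) * a"
  have r: "0 \<le> r" "r \<le> int n - 1"
    using three_sides by (auto simp: r_def zle_diff1_eq)
  have "m = int n * (m div int n) + r" by (simp add: r_def)
  then have "of_int m = real n * of_int (m div int n) + (of_int r :: real)"
    by (metis of_int_add of_int_mult of_int_of_nat_eq)
  then have "2 * of_int m * a = 2 * (real n * a) * of_int (m div int n) + 2 * of_int r * a"
    by (simp add: algebra_simps)
  then have "(2 * of_int m + 1) * a = y + 2 * pi * of_int (m div int n)"
    unfolding n_angle by (simp add: y_def algebra_simps)
  then have cos_y: "cos ((2 * of_int m + 1) * a) = cos y" by (simp only: cos_shift)
  have "real_of_int 0 \<le> of_int r" using r(1) of_int_le_iff by blast
  then have "1 * a \<le> y" unfolding y_def using angle_bounds by (intro mult_right_mono) auto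
  have "real_of_int r \<le> of_int (int n - 1)" using r(2) of_int_le_iff by blast
  then have "y \<le> (2 * real n - 1) * a" unfolding y_def using angle_bounds by (intro mult_right_mono) auto
  then have "a \<le> 2 * pi - y" using n_angle by (simp add: algebra_simps)
  have "cos y \<le> cos a"
  proof (cases "y \<le> pi")
    case True
    then show ?thesis using \<open>1 * a \<le> y\<close> angle_bounds by (intro cos_monotone_0_pi_le) auto
  next
    case False
    have "cos (2 * pi - y) \<le> cos a"
      using False \<open>a \<le> 2 * pi - y\<close> angle_bounds by (intro cos_monotone_0_pi_le) auto
    then show ?thesis by simp
  qed
  then show ?thesis using cos_y by simp
qed

lemma nrm_vert: "nrm k \<bullet> vert n i = cos ((2 * of_int (int i - int k - 1) + 1) * a)"
proof -
  have "(2 * of_int (int i - int k - 1) + 1) * a = 2 * real i * a - (2 * real k + 1) * a"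
    by (simp add: algebra_simps)
  then show ?thesis
    unfolding nrm_def vert_def inner_Pair inner_real_def by (simp add: cos_diff algebra_simps)
qed

lemma nrm_vert_le: "nrm k \<bullet> vert n i \<le> cos a"
  unfolding nrm_vert by (rule cos_odd_multiple_le)

text \<open>If both ends of side \<open>i\<close> lie on the line of side \<open>k\<close>, then
  \<open>cos (d - a) = cos (d + a) = cos a\<close> for the angle \<open>d\<close> between the two normals; the first
  equation gives \<open>sin d = 0\<close>, and then the second gives \<open>cos d = 1\<close>.\<close>

lemma side_in_side_line_unique:
  assumes "nrm k \<bullet> vert n i = cos a" and "nrm k \<bullet> vert n (Suc i) = cos a"
  shows "i mod n = k mod n"
proof -
  define d where "d = 2 * (real i - real k) * a"
  have "cos (d - a) = cos a" "cos (d + a) = cos a"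
    using assms unfolding nrm_vert d_def by (simp_all add: algebra_simps)
  then have "cos d * cos a + sin d * sin a = cos a" "cos d * cos a - sin d * sin a = cos a"
    by (simp_all add: cos_add cos_diff)
  then have "cos d * cos a = cos a" by linarith
  then have "cos d = 1" using cos_pos by simp
  then obtain q :: int where "d = of_int q * 2 * pi"
    using cos_one_2pi_int by blast
  then have "2 * ((real i - real k) * a) = 2 * (of_int q * (real n * a))"
    unfolding n_angle by (simp add: d_def algebra_simps)
  then have "(real i - real k) * a = (of_int q * real n) * a" by simp
  then have "real i - real k = of_int q * real n" using angle_bounds by simp
  then have "real_of_int (int i - int k) = real_of_int (q * int n)" by simp
  then have "int i - int k = q * int n" using of_int_eq_iff by blast
  then have "int i mod int n = int k mod int n"
    by (metis mod_mult_self1 diff_add_cancel add.commute)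
  then show ?thesis by (metis of_nat_mod of_nat_eq_iff)
qed

lemma nrm_side_pt_le:
  assumes "\<bar>x\<bar> \<le> 1"
  shows "nrm k \<bullet> side_pt i x \<le> cos a"
proof -
  have "nrm k \<bullet> side_pt i x
      = ((1 - x) / 2) * (nrm k \<bullet> vert n i) + ((1 + x) / 2) * (nrm k \<bullet> vert n (Suc i))"
    by (simp add: side_pt_convex_comb inner_right_distrib)
  also have "\<dots> \<le> ((1 - x) / 2) * cos a + ((1 + x) / 2) * cos a"
    using assms nrm_vert_le by (intro add_mono mult_left_mono) auto
  finally show ?thesis by (simp add: field_simps)
qed

lemma nrm_side_pt_less:
  assumes "\<bar>x\<bar> < 1" and "i mod n \<noteq> k mod n"
  shows "nrm k \<bullet> side_pt i x < cos a"
proof -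
  let ?p = "nrm k \<bullet> vert n i" and ?q = "nrm k \<bullet> vert n (Suc i)"
  have w: "0 < (1 - x) / 2" "0 < (1 + x) / 2" using assms(1) by auto
  have le: "?p \<le> cos a" "?q \<le> cos a" by (rule nrm_vert_le)+
  have "?p < cos a \<or> ?q < cos a"
    using side_in_side_line_unique[of k i] assms(2) le by linarith
  then have "((1 - x) / 2) * ?p + ((1 + x) / 2) * ?q < ((1 - x) / 2) * cos a + ((1 + x) / 2) * cos a"
    using w le by (auto intro: add_less_le_mono add_le_less_mono)
  moreover have "nrm k \<bullet> side_pt i x = ((1 - x) / 2) * ?p + ((1 + x) / 2) * ?q"
    by (simp add: side_pt_convex_comb inner_right_distrib)
  ultimately show ?thesis by (simp add: field_simps)
qed

definition ngon :: "plane set" where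
  "ngon = convex hull (vert n ` {..<n})"

lemma vert_mod: "vert n (k mod n) = vert n k"
  by (simp add: vert_eq_side_pt side_pt_mod)

lemma vert_in_ngon: "vert n k \<in> ngon"
proof -
  have "vert n (k mod n) \<in> vert n ` {..<n}" using three_sides by auto
  then show ?thesis unfolding ngon_def vert_mod by (rule hull_inc)
qed

lemma convex_ngon: "convex ngon"
  by (simp add: ngon_def)

lemma side_pt_in_ngon: "\<bar>x\<bar> \<le> 1 \<Longrightarrow> side_pt k x \<in> ngon"
  unfolding side_pt_convex_comb
  by (intro convexD[OF convex_ngon] vert_in_ngon) (auto simp: field_simps)

text \<open>The origin is the mean of the vertices; both coordinate sums telescope after
  multiplication by \<open>2 * sin a\<close>.\<close>

lemma origin_in_ngon: "0 \<in> ngon"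
proof -
  have "2 * sin a * (\<Sum>i<m. cos (2 * real i * a)) = sin ((2 * real m - 1) * a) + sin a"
    and "2 * sin a * (\<Sum>i<m. sin (2 * real i * a)) = cos a - cos ((2 * real m - 1) * a)" for m
  proof (induction m)
    case (Suc m)
    {
      case 1
      have "2 * sin a * cos (2 * real m * a)
          = sin (2 * real m * a + a) - sin (2 * real m * a - a)"
        by (simp add: sin_add sin_diff)
      then show ?case using Suc(1) by (simp add: algebra_simps)
    next
      case 2
      have "2 * sin a * sin (2 * real m * a)
          = cos (2 * real m * a - a) - cos (2 * real m * a + a)"
        by (simp add: cos_add cos_diff)
      then show ?case using Suc(2) by (simp add: algebra_simps)
    }
  qed simp_all
  from this[of n] have "(\<Sum>i<n. vert n i) = 0"
  proof -
    assume S: "2 * sin a * (\<Sum>i<n. cos (2 * real i * a)) = sin ((2 * real n - 1) * a) + sin a"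
      "2 * sin a * (\<Sum>i<n. sin (2 * real i * a)) = cos a - cos ((2 * real n - 1) * a)"
    have "(2 * real n - 1) * a = 2 * pi - a" using n_angle by (simp add: algebra_simps)
    then show ?thesis
      using S sin_pos by (simp add: prod_eq_iff fst_sum snd_sum vert_def)
  qed
  moreover have "(\<Sum>i<n. (1 / real n) *\<^sub>R vert n i) \<in> ngon"
    using three_sides vert_in_ngon by (intro convex_sum convex_ngon) auto
  ultimately show ?thesis by (simp flip: scaleR_sum_right)
qed

text \<open>Neighbouring normals are at angle \<open>2 * a\<close>, so a point whose largest normal coordinate
  is the \<open>k\<close>-th one lies in the cone from the origin over side \<open>k\<close>.\<close>

lemma max_nrm_cone:
  assumes max: "\<And>i. nrm i \<bullet> p \<le> nrm k \<bullet> p"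
  shows "\<bar>tng k \<bullet> p\<bar> * cos a \<le> (nrm k \<bullet> p) * sin a"
proof -
  let ?M = "nrm k \<bullet> p" and ?t = "tng k \<bullet> p"
  have "nrm (Suc k) \<bullet> p = cos (2 * a) * ?M + sin (2 * a) * ?t"
    by (simp add: nrm_Suc inner_left_distrib)
  then have 1: "cos (2 * a) * ?M + sin (2 * a) * ?t \<le> ?M" using max by metis
  \<comment> \<open>the side before \<open>k\<close>, shifted by \<open>n\<close> to cover \<open>k = 0\<close>\<close>
  define l where "l = k + n - 1"
  have "Suc l = k + n" using three_sides by (simp add: l_def)
  then have k: "nrm k = nrm (Suc l)" "tng k = tng (Suc l)"
    by (metis mod_add_self2 nrm_mod, metis mod_add_self2 tng_mod)
  have "nrm l = cos (2 * a) *\<^sub>R nrm k - sin (2 * a) *\<^sub>R tng k"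
    unfolding k by (rule nrm_pred)
  then have "nrm l \<bullet> p = cos (2 * a) * ?M - sin (2 * a) * ?t"
    by (simp add: inner_diff_left)
  then have 2: "cos (2 * a) * ?M - sin (2 * a) * ?t \<le> ?M" using max by metis
  have "sin (2 * a) * \<bar>?t\<bar> \<le> (1 - cos (2 * a)) * ?M"
    using 1 2 by (simp add: abs_if algebra_simps)
  then have "(2 * sin a) * (\<bar>?t\<bar> * cos a) \<le> (2 * sin a) * (?M * sin a)"
    unfolding sin_double cos_double_sin by (simp add: power2_eq_square mult_ac)
  then show ?thesis using sin_pos by (simp add: mult_le_cancel_left_pos)
qed

lemma halfplanes_all:
  assumes "\<forall>k<n. nrm k \<bullet> p \<le> c" shows "nrm k \<bullet> p \<le> c"
proof -
  have "k mod n < n" using three_sides by simp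
  then show ?thesis using assms nrm_mod by metis
qed

lemma halfplane_boundary_is_side:
  assumes "\<forall>k<n. nrm k \<bullet> p \<le> cos a" and "nrm k \<bullet> p = cos a"
  obtains x where "\<bar>x\<bar> \<le> 1" "p = side_pt k x"
proof -
  have "\<bar>tng k \<bullet> p\<bar> * cos a \<le> cos a * sin a"
    using max_nrm_cone[of p k] halfplanes_all[OF assms(1)] assms(2) by simp
  then have "\<bar>(tng k \<bullet> p) / sin a\<bar> \<le> 1"
    using cos_pos sin_pos by (simp add: mult.commute[of _ "cos a"] abs_divide)
  moreover have "p = side_pt k ((tng k \<bullet> p) / sin a)"
    using frame_expansion[of p k] assms(2) sin_pos by (simp add: side_pt_def)
  ultimately show thesis using that by blast
qed

text \<open>Rescaling a point of the cone over side \<open>k\<close> moves it onto that side, so a point of all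
  half-planes is a convex combination of the origin and a point of a side.\<close>

lemma ngon_eq_halfplanes: "ngon = {p. \<forall>k<n. nrm k \<bullet> p \<le> cos a}"
proof
  have "convex {p. \<forall>k<n. nrm k \<bullet> p \<le> cos a}"
    unfolding convex_alt
    by (auto simp: inner_right_distrib intro!: convex_bound_le)
  moreover have "vert n ` {..<n} \<subseteq> {p. \<forall>k<n. nrm k \<bullet> p \<le> cos a}"
    using nrm_vert_le by auto
  ultimately show "ngon \<subseteq> {p. \<forall>k<n. nrm k \<bullet> p \<le> cos a}"
    unfolding ngon_def by (simp add: hull_minimal)
next
  show "{p. \<forall>k<n. nrm k \<bullet> p \<le> cos a} \<subseteq> ngon"
  proof safe
    fix u w assume le: "\<forall>k<n. nrm k \<bullet> (u, w) \<le> cos a"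
    define p where "p = (u, w)"
    let ?A = "(\<lambda>i. nrm i \<bullet> p) ` {..<n}"
    have fin: "finite ?A" by simp
    have "0 < n" using three_sides by simp
    then have "?A \<noteq> {}" by blast
    then have "Max ?A \<in> ?A" using fin by (rule Max_in[rotated])
    then obtain k where "k < n" and k: "Max ?A = nrm k \<bullet> p" by blast
    let ?M = "nrm k \<bullet> p"
    have "nrm i \<bullet> p \<le> ?M" if "i < n" for i
      unfolding k[symmetric] using that by (intro Max_ge[OF fin] imageI) simp
    then have "\<forall>i<n. nrm i \<bullet> p \<le> ?M" by blast
    then have cone: "\<bar>tng k \<bullet> p\<bar> * cos a \<le> ?M * sin a"
      using max_nrm_cone halfplanes_all by blast
    then have "0 \<le> ?M * sin a" using cos_pos by (meson abs_ge_zero mult_nonneg_nonneg less_imp_le order_trans)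
    then have "0 \<le> ?M" using sin_pos by (simp add: zero_le_mult_iff)
    have "?M \<le> cos a" using le \<open>k < n\<close> by (simp add: p_def)
    show "(u, w) \<in> ngon"
    proof (cases "?M = 0")
      case True
      then have "\<bar>tng k \<bullet> p\<bar> * cos a \<le> 0" using cone by simp
      then have "tng k \<bullet> p = 0" using cos_pos by (simp add: mult_le_0_iff)
      then have "p = 0" using True frame_expansion[of p k] by simp
      then show ?thesis using origin_in_ngon by (simp add: p_def)
    next
      case False
      then have "0 < ?M" using \<open>0 \<le> ?M\<close> by simp
      define x where "x = (tng k \<bullet> p) * cos a / (?M * sin a)"
      have "\<bar>x\<bar> \<le> 1"
        using cone \<open>0 < ?M\<close> sin_pos cos_pos by (simp add: x_def abs_mult)
      have "p = (?M / cos a) *\<^sub>R side_pt k x"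
        using frame_expansion[of p k] \<open>0 < ?M\<close> sin_pos cos_pos
        by (simp add: side_pt_def x_def scaleR_right_distrib)
      then have "p = (?M / cos a) *\<^sub>R side_pt k x + (1 - ?M / cos a) *\<^sub>R 0" by simp
      moreover have "0 \<le> ?M / cos a" "0 \<le> 1 - ?M / cos a"
        using \<open>0 \<le> ?M\<close> \<open>?M \<le> cos a\<close> cos_pos by simp_all
      ultimately show ?thesis
        using convexD[OF convex_ngon side_pt_in_ngon[OF \<open>\<bar>x\<bar> \<le> 1\<close>] origin_in_ngon]
        by (metis p_def add.commute diff_add_cancel)
    qed
  qed
qed

lemma interior_ngon: "interior ngon = {p. \<forall>k<n. nrm k \<bullet> p < cos a}"
proof
  show "interior ngon \<subseteq> {p. \<forall>k<n. nrm k \<bullet> p < cos a}"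
  proof safe
    fix u w k assume p: "(u, w) \<in> interior ngon" and k: "k < n"
    have "ngon \<subseteq> {p. nrm k \<bullet> p \<le> cos a}" using k by (auto simp: ngon_eq_halfplanes)
    then have "(u, w) \<in> interior {p. nrm k \<bullet> p \<le> cos a}" using p interior_mono by blast
    moreover have "nrm k \<noteq> 0" using inner_frame(1)[of k] by fastforce
    ultimately show "nrm k \<bullet> (u, w) < cos a" by (simp add: interior_halfspace_le)
  qed
next
  have "{p. \<forall>k<n. nrm k \<bullet> p < cos a} = (\<Inter>k<n. {p. nrm k \<bullet> p < cos a})" by auto
  then have "open {p. \<forall>k<n. nrm k \<bullet> p < cos a}"
    by (simp add: open_INT open_halfspace_lt)
  moreover have "{p. \<forall>k<n. nrm k \<bullet> p < cos a} \<subseteq> ngon"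
    by (auto simp: ngon_eq_halfplanes intro: less_imp_le)
  ultimately show "{p. \<forall>k<n. nrm k \<bullet> p < cos a} \<subseteq> interior ngon"
    by (rule interior_maximal[rotated])
qed

lemma origin_in_interior: "0 \<in> interior ngon"
  using cos_pos by (simp add: interior_ngon)

lemma compact_ngon: "compact ngon"
  unfolding ngon_def by (rule finite_imp_compact_convex_hull) simp

lemma closure_interior_ngon: "closure (interior ngon) = ngon"
  using convex_closure_interior[OF convex_ngon] origin_in_interior
    compact_imp_closed[OF compact_ngon] by auto

lemma frontier_interior_ngon: "frontier (interior ngon) = (\<Union>k<n. side_pt k ` {-1..1})"
proof
  show "frontier (interior ngon) \<subseteq> (\<Union>k<n. side_pt k ` {-1..1})"
  proof
    fix p assume "p \<in> frontier (interior ngon)"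
    then have "p \<in> ngon" "p \<notin> interior ngon"
      by (simp_all add: frontier_def closure_interior_ngon)
    then have le: "\<forall>k<n. nrm k \<bullet> p \<le> cos a" and "\<exists>k<n. nrm k \<bullet> p \<ge> cos a"
      unfolding interior_ngon by (simp_all add: ngon_eq_halfplanes not_less)
    then obtain k where "k < n" "nrm k \<bullet> p = cos a" by (meson order_antisym)
    then obtain x where "\<bar>x\<bar> \<le> 1" "p = side_pt k x"
      using halfplane_boundary_is_side le by blast
    then show "p \<in> (\<Union>k<n. side_pt k ` {-1..1})" 
      using \<open>k < n\<close> by (intro UN_I[of k] image_eqI[of _ _ x]) (auto simp: abs_le_iff)
  qed
next
  show "(\<Union>k<n. side_pt k ` {-1..1}) \<subseteq> frontier (interior ngon)"
  proof
    fix p assume "p \<in> (\<Union>k<n. side_pt k ` {-1..1})"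
    then obtain k x where p: "p = side_pt k x" and "k < n" "\<bar>x\<bar> \<le> 1"
      by (fastforce simp: abs_le_iff)
    then have "p \<in> ngon" by (simp add: side_pt_in_ngon)
    moreover have "p \<notin> interior ngon"
      using \<open>k < n\<close> unfolding interior_ngon by (auto simp: p intro!: exI[of _ k])
    ultimately show "p \<in> frontier (interior ngon)"
      by (simp add: frontier_def closure_interior_ngon)
  qed
qed

text \<open>For the line of each side, at least one end of the chord lies strictly on its inner
  side, since the two ends are interior to different sides.\<close>

lemma chord_in_interior:
  assumes "\<bar>x\<bar> < 1" "\<bar>y\<bar> < 1" and "i mod n \<noteq> k mod n"
  shows "open_segment (side_pt i x) (side_pt k y) \<subseteq> interior ngon"
proof
  fix p assume "p \<in> open_segment (side_pt i x) (side_pt k y)"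
  then obtain u where u: "0 < u" "u < 1" and p: "p = (1 - u) *\<^sub>R side_pt i x + u *\<^sub>R side_pt k y"
    by (auto simp: in_segment)
  show "p \<in> interior ngon"
    unfolding interior_ngon
  proof safe
    fix l
    let ?p = "nrm l \<bullet> side_pt i x" and ?q = "nrm l \<bullet> side_pt k y"
    have le: "?p \<le> cos a" "?q \<le> cos a" using assms(1,2) by (simp_all add: nrm_side_pt_le)
    have "?p < cos a \<or> ?q < cos a" using assms nrm_side_pt_less by metis
    then have "(1 - u) * ?p + u * ?q < (1 - u) * cos a + u * cos a"
      using u le by (auto intro: add_less_le_mono add_le_less_mono)
    then show "nrm l \<bullet> p < cos a"
      unfolding p by (simp add: inner_right_distrib algebra_simps)
  qed
qed

end


section \<open>Reflection at the sides\<close>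

locale regular_pencils = regular_polygon +
  fixes j :: nat
  assumes j_pos: "1 \<le> j" and j_small: "real j < real n / 2"
begin

abbreviation B :: proj_polygon where "B \<equiv> regular_billiard n j"

definition psi :: real where "psi = real j * pi / real n"

lemma psi_bounds: "0 < psi" "psi < pi / 2"
proof -
  show "0 < psi" using j_pos three_sides by (simp add: psi_def)
  have "real j / real n < 1 / 2" using j_small three_sides by (simp add: field_simps)
  then have "real j / real n * pi < 1 / 2 * pi" by (rule mult_strict_right_mono) simp
  then show "psi < pi / 2" by (simp add: psi_def)
qed

lemma sin_psi_pos: "0 < sin psi" and cos_psi_pos: "0 < cos psi"
  using psi_bounds by (auto intro: sin_gt_zero cos_gt_zero)

lemma cos_theta: "cos (theta n j) = 1 - 2 * (cos psi)\<^sup>2"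
proof -
  have "theta n j = pi - 2 * psi"
    using three_sides by (simp add: theta_def psi_def field_simps)
  then show ?thesis by (simp add: cos_double_cos)
qed

text \<open>The distance \<open>cos a + lambda_coeff n j\<close> from the centre \<open>O\<close> of a pencil to its side
  is nonzero, and its product with \<open>(cos psi)\<^sup>2\<close> does not involve \<open>j\<close>. This relation is
  all that the reflection law uses of the value of \<open>\<lambda>\<close>.\<close>

lemma pencil_distance: "(cos a + lambda_coeff n j) * (cos psi)\<^sup>2 = cos a * (sin a)\<^sup>2"
proof -
  define c where "c = (cos psi)\<^sup>2"
  define v where "v = cos a"
  have "c \<noteq> 0" using cos_psi_pos by (simp add: c_def)
  have "lambda_coeff n j = v * (2 * v\<^sup>2 - 1 - (1 - 2 * c)) / (1 - 2 * c - 1)"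
    unfolding lambda_coeff_def Let_def cos_theta c_def v_def ..
  also have "\<dots> = v * (1 - v\<^sup>2 - c) / c" using \<open>c \<noteq> 0\<close> by (simp add: field_simps)
  finally have "lambda_coeff n j * c = v * (1 - v\<^sup>2 - c)" using \<open>c \<noteq> 0\<close> by simp
  then have "(v + lambda_coeff n j) * c = v * (1 - v\<^sup>2)" by (simp add: algebra_simps)
  then show ?thesis by (simp add: c_def v_def sin_squared_eq)
qed

lemma pencil_distance_nonzero: "cos a + lambda_coeff n j \<noteq> 0"
proof
  assume "cos a + lambda_coeff n j = 0"
  then have "cos a * (sin a)\<^sup>2 = 0" using pencil_distance by simp
  then show False using cos_pos sin_pos by simp
qed

lemma centre_eq: "centre n j k = - lambda_coeff n j *\<^sub>R nrm k"
proof -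
  have "side_mid n k = (1 - 1 / 2) *\<^sub>R vert n k + (1 / 2) *\<^sub>R vert n (Suc k)"
    by (simp add: side_mid_def midpoint_def scaleR_right_distrib)
  also have "\<dots> = cos a *\<^sub>R nrm k"
    unfolding side_pt_segment by (simp add: side_pt_def)
  finally have "side_mid n k = cos a *\<^sub>R nrm k" .
  moreover have "norm (nrm k) = 1" by (simp add: norm_eq_1)
  ultimately show ?thesis using cos_pos by (simp add: centre_def sgn_div_norm)
qed

lemma det2_frame:
  "det2 (u *\<^sub>R tng k + w *\<^sub>R nrm k) (u' *\<^sub>R tng k + w' *\<^sub>R nrm k) = w * u' - u * w'"
proof -
  define c where "c = cos ((2 * real k + 1) * a)"
  define s where "s = sin ((2 * real k + 1) * a)"
  have "c * c + s * s = 1" unfolding c_def s_def by (simp flip: power2_eq_square)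
  then have "(w * c - u * s) * (u' * c + w' * s) - (u * c + w * s) * (w' * c - u' * s)
      = w * u' - u * w'"
    by algebra
  moreover have "nrm k = (c, s)" "tng k = (- s, c)"
    by (simp_all add: nrm_def tng_def c_def s_def)
  ultimately show ?thesis by (simp add: det2_def)
qed

lemma det2_frame_tng: "det2 (u *\<^sub>R tng k + w *\<^sub>R nrm k) (tng k) = w"
  using det2_frame[of u k w 1 0] by simp

lemma side_line_eq: "affine hull {vert n k, vert n (Suc k)} = dir_line (side_pt k x) (tng k)"
proof -
  have dir: "vert n (Suc k) - vert n k = (2 * sin a) *\<^sub>R tng k"
    unfolding vert_eq_side_pt[of k] vert_Suc_eq_side_pt
    by (simp add: side_pt_def flip: scaleR_left_distrib)
  have base: "vert n k = side_pt k x + (- sin a * (1 + x)) *\<^sub>R tng k"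
    unfolding vert_eq_side_pt[of k] by (simp add: side_pt_def algebra_simps)
  show ?thesis
    unfolding affine_hull_eq_dir_line dir
    by (rule dir_line_change[OF base]) (use sin_pos in simp)
qed

text \<open>In the frame of the middle side the chords to its two neighbours have explicit
  coordinates, in which the harmonic equation becomes a polynomial relation between three
  consecutive side parameters.\<close>

lemma reflection_at_side:
  assumes "x \<noteq> 1" and "z \<noteq> -1"
    and rel: "(1 - y) * (1 - x) - (1 + y) * (1 + z)
      = - 4 * (cos psi)\<^sup>2 * y * (1 + z) * (1 - x)"
  shows "proj_reflects (side_pt (Suc i) y)
      (affine hull {vert n (Suc i), vert n (Suc (Suc i))})
      (affine hull {side_pt (Suc i) y, centre n j (Suc i)})
      (affine hull {side_pt i x, side_pt (Suc i) y})
      (affine hull {side_pt (Suc i) y, side_pt (Suc (Suc i)) z})"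
proof -
  let ?P = "side_pt (Suc i) y" and ?T = "tng (Suc i)" and ?N = "nrm (Suc i)"
  define v where "v = cos a"
  define s where "s = sin a"
  define h where "h = v + lambda_coeff n j"
  define c where "c = (cos psi)\<^sup>2"
  have trig: "cos (2 * a) = 2 * v * v - 1" "sin (2 * a) = 2 * s * v" "s * s + v * v = 1"
    by (simp_all add: v_def s_def cos_double_cos sin_double flip: power2_eq_square)
  have h: "h * c = v * s * s" using pencil_distance
    by (simp add: h_def v_def s_def c_def power2_eq_square mult.assoc)
  have pos: "v \<noteq> 0" "s \<noteq> 0" "h \<noteq> 0"
    using cos_pos sin_pos pencil_distance_nonzero by (simp_all add: v_def s_def h_def)
  define A1 where "A1 = s * (- 2 * v * v + x * (2 * v * v - 1) - y)"
  define B1 where "B1 = - 2 * v * s * s * (1 - x)"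
  define A2 where "A2 = s * (2 * v * v + z * (2 * v * v - 1) - y)"
  define B2 where "B2 = - 2 * v * s * s * (1 + z)"
  have vv: "v * (2 * v * v - 1) - v = - 2 * v * s * s" using trig(3) by algebra
  have u1: "side_pt i x - ?P = A1 *\<^sub>R ?T + B1 *\<^sub>R ?N"
  proof -
    have "side_pt i x - ?P = (- v * (2 * s * v) + s * x * (2 * v * v - 1) - s * y) *\<^sub>R ?T
        + (v * (2 * v * v - 1) - v + s * x * (2 * s * v)) *\<^sub>R ?N"
      unfolding side_pt_def nrm_pred[of i] tng_pred[of i] trig v_def[symmetric] s_def[symmetric]
      by (cases "nrm (Suc i)"; cases "tng (Suc i)") (simp add: algebra_simps)
    then show ?thesis unfolding vv by (simp add: A1_def B1_def algebra_simps)
  qed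
  have u2: "side_pt (Suc (Suc i)) z - ?P = A2 *\<^sub>R ?T + B2 *\<^sub>R ?N"
  proof -
    have "side_pt (Suc (Suc i)) z - ?P
        = (v * (2 * s * v) + s * z * (2 * v * v - 1) - s * y) *\<^sub>R ?T
        + (v * (2 * v * v - 1) - v - s * z * (2 * s * v)) *\<^sub>R ?N"
      unfolding side_pt_def nrm_Suc[of "Suc i"] tng_Suc[of "Suc i"] trig
        v_def[symmetric] s_def[symmetric]
      by (cases "nrm (Suc i)"; cases "tng (Suc i)") (simp add: algebra_simps)
    then show ?thesis unfolding vv by (simp add: A2_def B2_def algebra_simps)
  qed
  have u4: "centre n j (Suc i) - ?P = (- s * y) *\<^sub>R ?T + (- h) *\<^sub>R ?N"
    by (simp add: centre_eq side_pt_def h_def v_def s_def algebra_simps)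
  have dets: "det2 (side_pt i x - ?P) ?T = B1"
    "det2 (side_pt (Suc (Suc i)) z - ?P) ?T = B2"
    "det2 (centre n j (Suc i) - ?P) ?T = - h"
    "det2 (side_pt i x - ?P) (centre n j (Suc i) - ?P) = - B1 * s * y + A1 * h"
    "det2 (side_pt (Suc (Suc i)) z - ?P) (centre n j (Suc i) - ?P) = - B2 * s * y + A2 * h"
    unfolding u1 u2 u4 det2_frame det2_frame_tng by simp_all
  have "B1 * A2 + A1 * B2 = - 2 * v * s * s * s * ((1 - y) * (1 - x) - (1 + y) * (1 + z))"
    unfolding A1_def A2_def B1_def B2_def by algebra
  also have "\<dots> = 8 * v * s * s * s * c * y * (1 + z) * (1 - x)"
    unfolding rel c_def by algebra
  finally have "h * (B1 * A2 + A1 * B2) = 8 * v * s * s * s * (h * c) * y * (1 + z) * (1 - x)"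
    by simp
  also have "\<dots> = 2 * s * y * B1 * B2" unfolding h B1_def B2_def by algebra
  finally have harmonic: "B1 * (- B2 * s * y + A2 * h) + (- B1 * s * y + A1 * h) * B2 = 0"
    by algebra
  have "proj_reflects ?P (dir_line ?P ?T) (dir_line ?P (centre n j (Suc i) - ?P))
      (dir_line ?P (side_pt i x - ?P)) (dir_line ?P (side_pt (Suc (Suc i)) z - ?P))"
    using pos assms(1,2) harmonic
    by (intro proj_reflectsI) (auto simp: dets B1_def B2_def)
  moreover have "{side_pt i x, ?P} = {?P, side_pt i x}" by blast
  ultimately show ?thesis
    unfolding side_line_eq[of "Suc i" y] by (simp add: affine_hull_eq_dir_line)
qed

lemma billiard_sides:
  "side_segment B k = side_pt k ` {-1..1}"
  "side_interior B k = side_pt k ` {-1<..<1}"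
  "side_line B k = affine hull {vert n k, vert n (Suc k)}"
  by (simp_all add: side_segment_def side_interior_def side_line_def regular_billiard_def
      side_closed_segment side_open_segment)

lemma billiard_fields:
  "pb_domain B = interior ngon" "pb_nsides B = n"
  "pb_trans B k p = affine hull {p, centre n j k}"
  by (simp_all add: regular_billiard_def ngon_def)

lemma projective_billiard: "projective_billiard B"
proof -
  have trans: "is_line (pb_trans B k p) \<and> p \<in> pb_trans B k p \<and> pb_trans B k p \<noteq> side_line B k"
    if p: "p \<in> side_interior B k" for k p
  proof -
    obtain x where x: "p = side_pt k x" using p by (auto simp: billiard_sides)
    have on_side: "nrm k \<bullet> q = cos a" if q: "q \<in> side_line B k" for q
    proof -
      obtain t where "q = side_pt k 0 + t *\<^sub>R tng k"
        using q unfolding billiard_sides side_line_eq[of k 0] dir_line_def by blast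
      then show ?thesis by (simp add: inner_right_distrib)
    qed
    have "nrm k \<bullet> centre n j k \<noteq> cos a"
      using pencil_distance_nonzero by (simp add: centre_eq)
    then have "centre n j k \<notin> side_line B k" "centre n j k \<noteq> p"
      using on_side[of "centre n j k"] nrm_side_pt_self[of k x] unfolding x by metis+
    moreover have "centre n j k \<in> pb_trans B k p" "p \<in> pb_trans B k p"
      by (simp_all add: billiard_fields hull_inc)
    moreover have "is_line (pb_trans B k p)"
      using \<open>centre n j k \<noteq> p\<close>
      by (simp add: is_line_def billiard_fields aff_dim_2 affine_affine_hull aff_dim_affine_hull)
    ultimately show ?thesis by blast
  qed
  have disj: "side_interior B i \<inter> side_segment B k = {}" if "i < n" "k < n" "i \<noteq> k" for i k
  proof -
    have "nrm k \<bullet> p < cos a" if "p \<in> side_interior B i" for p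
      using that \<open>i < n\<close> \<open>k < n\<close> \<open>i \<noteq> k\<close> by (auto simp: billiard_sides abs_less_iff intro!: nrm_side_pt_less)
    moreover have "nrm k \<bullet> p = cos a" if "p \<in> side_segment B k" for p
      using that by (auto simp: billiard_sides)
    ultimately show ?thesis by fastforce
  qed
  have ends: "fst (pb_side B k) \<noteq> snd (pb_side B k)" for k
    using vert_distinct by (simp add: regular_billiard_def)
  have "convex (interior ngon)" by (rule convex_interior[OF convex_ngon])
  then have "connected (interior ngon)" by (rule convex_connected)
  moreover have "bounded (interior ngon)"
    using bounded_subset[OF compact_imp_bounded[OF compact_ngon] interior_subset] .
  ultimately show ?thesis
    unfolding projective_billiard_def billiard_fields(1,2)
    using trans disj ends origin_in_interior closure_interior_ngon frontier_interior_ngon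
    by (auto simp: billiard_sides(1))
qed


section \<open>Linearisation of the billiard map\<close>

text \<open>The numerators \<open>moment\<close> and denominators \<open>weight\<close> of the side parameters are
  trigonometric sums in \<open>2 * m * psi\<close>. The angle is shifted by \<open>- psi\<close> so that the impacts
  \<open>0\<close> and \<open>1\<close> sit symmetrically at \<open>- psi\<close> and \<open>psi\<close>: sums and differences of their
  values then give the amplitudes separately. The overall factor is fixed by
  \<open>weight x y 0 = 1 + y\<close>, which makes all coefficients polynomials in the starting
  parameters \<open>x\<close> and \<open>y\<close>.\<close>

definition amp_cos :: "real \<Rightarrow> real \<Rightarrow> real" where
  "amp_cos x y = (y - x - 2 * x * y) / (2 * (sin psi)\<^sup>2)"

definition amp_sin :: "real \<Rightarrow> real \<Rightarrow> real" where
  "amp_sin x y = - (x + y) / (2 * sin psi * cos psi)"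

definition mean :: "real \<Rightarrow> real \<Rightarrow> real" where
  "mean x y = (2 - x + y) / 2 - amp_cos x y * (cos psi)\<^sup>2"

definition weight :: "real \<Rightarrow> real \<Rightarrow> nat \<Rightarrow> real" where
  "weight x y m = mean x y + cos psi *
     (amp_cos x y * cos ((2 * real m - 1) * psi) + amp_sin x y * sin ((2 * real m - 1) * psi))"

definition moment :: "real \<Rightarrow> real \<Rightarrow> nat \<Rightarrow> real" where
  "moment x y m = sin psi *
     (amp_cos x y * sin ((2 * real m - 1) * psi) - amp_sin x y * cos ((2 * real m - 1) * psi))"

definition orbit :: "real \<Rightarrow> real \<Rightarrow> nat \<Rightarrow> plane" where
  "orbit x y m = side_pt m (moment x y m / weight x y m)"

definition admissible :: "real \<Rightarrow> real \<Rightarrow> bool" where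
  "admissible x y \<longleftrightarrow> (\<forall>m. \<bar>moment x y m\<bar> < weight x y m)"

lemma initial_values:
  "weight x y 0 = 1 + y" "moment x y 0 = x * (1 + y)"
  "weight x y 1 = 1 - x" "moment x y 1 = y * (1 - x)"
proof -
  let ?b = "amp_cos x y" and ?c = "amp_sin x y" and ?s = "sin psi" and ?k = "cos psi"
  have b: "?b * ?s * ?s = (y - x - 2 * x * y) / 2"
    using sin_psi_pos by (simp add: amp_cos_def power2_eq_square)
  have c: "?c * ?s * ?k = - (x + y) / 2"
    using sin_psi_pos cos_psi_pos by (simp add: amp_sin_def)
  have "weight x y 0 = (2 - x + y) / 2 - ?c * ?s * ?k"
    "weight x y 1 = (2 - x + y) / 2 + ?c * ?s * ?k"
    by (simp_all add: weight_def mean_def algebra_simps power2_eq_square)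
  then show "weight x y 0 = 1 + y" "weight x y 1 = 1 - x"
    unfolding c by (simp_all add: field_simps)
  have "moment x y 0 = - (?b * ?s * ?s) - ?c * ?s * ?k"
    "moment x y 1 = ?b * ?s * ?s - ?c * ?s * ?k"
    by (simp_all add: moment_def algebra_simps)
  then show "moment x y 0 = x * (1 + y)" "moment x y 1 = y * (1 - x)"
    unfolding b c by (simp_all add: field_simps)
qed

lemma weight_moment_recurrences:
  "weight x y m - moment x y m = weight x y (Suc m) + moment x y (Suc m)"
  "weight x y (Suc (Suc m)) = weight x y m - 4 * (cos psi)\<^sup>2 * moment x y (Suc m)"
proof -
  define t where "t = 2 * real m * psi"
  define b where "b = amp_cos x y"
  define c where "c = amp_sin x y"
  have ang: "(2 * real m - 1) * psi = t - psi" "(2 * real (Suc m) - 1) * psi = t + psi"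
    by (simp_all add: t_def algebra_simps)
  show "weight x y m - moment x y m = weight x y (Suc m) + moment x y (Suc m)"
    unfolding weight_def moment_def ang b_def[symmetric] c_def[symmetric]
    by (simp add: cos_add cos_diff sin_add sin_diff algebra_simps)
  define w where "w = (2 * real (Suc m) - 1) * psi"
  have ang': "(2 * real m - 1) * psi = w - 2 * psi" "(2 * real (Suc (Suc m)) - 1) * psi = w + 2 * psi"
    by (simp_all add: w_def algebra_simps)
  show "weight x y (Suc (Suc m)) = weight x y m - 4 * (cos psi)\<^sup>2 * moment x y (Suc m)"
    unfolding weight_def moment_def ang' w_def[symmetric] b_def[symmetric] c_def[symmetric]
      cos_add cos_diff sin_add sin_diff
    by (simp add: sin_double algebra_simps power2_eq_square)
qed

lemma periodic: "weight x y (m + n) = weight x y m" "moment x y (m + n) = moment x y m"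
proof -
  have "(2 * real (m + n) - 1) * psi = (2 * real m - 1) * psi + 2 * pi * of_int (int j)"
    using three_sides by (simp add: psi_def field_simps)
  then show "weight x y (m + n) = weight x y m" "moment x y (m + n) = moment x y m"
    unfolding weight_def moment_def by (simp_all only: cos_shift sin_shift)
qed

lemma orbit_periodic: "orbit x y (m + n) = orbit x y m"
proof -
  have "side_pt (m + n) z = side_pt m z" for z by (metis mod_add_self2 side_pt_mod)
  then show ?thesis by (simp add: orbit_def periodic)
qed

lemma orbit_initial:
  assumes "\<bar>x\<bar> < 1" "\<bar>y\<bar> < 1"
  shows "orbit x y 0 = side_pt 0 x" "orbit x y 1 = side_pt 1 y"
proof -
  have "1 + y \<noteq> 0" "1 - x \<noteq> 0" using assms by auto
  then show "orbit x y 0 = side_pt 0 x" "orbit x y 1 = side_pt 1 y"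
    unfolding orbit_def initial_values by simp_all
qed

text \<open>The mean is \<open>1\<close> and the amplitudes are \<open>0\<close> at the origin, and all three depend
  continuously on \<open>(x, y)\<close>. The bound "mean greater than twice the sum of the amplitudes" holds
  near the origin and serves all \<open>m\<close> at once.\<close>

lemma admissible_near_0:
  obtains e where "0 < e" "e \<le> 1" "\<And>x y. \<bar>x\<bar> < e \<Longrightarrow> \<bar>y\<bar> < e \<Longrightarrow> admissible x y"
proof -
  define h where
    "h p = mean (fst p) (snd p) - 2 * (\<bar>amp_cos (fst p) (snd p)\<bar> + \<bar>amp_sin (fst p) (snd p)\<bar>)" for p
  have "continuous_on UNIV h"
    unfolding h_def mean_def amp_cos_def amp_sin_def
    using sin_psi_pos cos_psi_pos by (intro continuous_intros) auto
  then have "open (h -` {0<..})" by (intro open_vimage) auto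
  moreover have "(0, 0) \<in> h -` {0<..}"
    by (simp add: h_def mean_def amp_cos_def amp_sin_def)
  ultimately obtain d where d: "0 < d" "ball (0, 0) d \<subseteq> h -` {0<..}"
    by (rule openE)
  \<comment> \<open>half of \<open>d\<close>, since the norm of \<open>(x, y)\<close> is at most \<open>\<bar>x\<bar> + \<bar>y\<bar>\<close>\<close>
  define e where "e = min 1 (d / 2)"
  have "admissible x y" if "\<bar>x\<bar> < e" "\<bar>y\<bar> < e" for x y
  proof -
    let ?b = "amp_cos x y" and ?c = "amp_sin x y"
    have "norm (x, y) \<le> \<bar>x\<bar> + \<bar>y\<bar>" using norm_Pair_le[of x y] by simp
    then have "norm (x, y) < d" using that by (simp add: e_def)
    then have "(x, y) \<in> ball (0, 0) d" by (simp add: dist_norm norm_Pair)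
    then have h: "2 * (\<bar>?b\<bar> + \<bar>?c\<bar>) < mean x y" using d(2) by (force simp: h_def)
    have osc: "\<bar>k * (?b * u + ?c * w)\<bar> \<le> \<bar>?b\<bar> + \<bar>?c\<bar>"
      if "\<bar>k\<bar> \<le> 1" "\<bar>u\<bar> \<le> 1" "\<bar>w\<bar> \<le> 1" for k u w
    proof -
      have "\<bar>?b * u + ?c * w\<bar> \<le> \<bar>?b\<bar> * \<bar>u\<bar> + \<bar>?c\<bar> * \<bar>w\<bar>"
        by (metis abs_mult abs_triangle_ineq)
      also have "\<dots> \<le> \<bar>?b\<bar> + \<bar>?c\<bar>" using that by (intro add_mono mult_left_le) auto
      finally have "\<bar>?b * u + ?c * w\<bar> \<le> \<bar>?b\<bar> + \<bar>?c\<bar>" .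
      moreover have "\<bar>k\<bar> * \<bar>?b * u + ?c * w\<bar> \<le> 1 * \<bar>?b * u + ?c * w\<bar>"
        using that(1) by (intro mult_right_mono) auto
      ultimately show ?thesis by (simp add: abs_mult)
    qed
    show ?thesis
      unfolding admissible_def
    proof
      fix m
      let ?t = "(2 * real m - 1) * psi"
      define S where "S = \<bar>?b\<bar> + \<bar>?c\<bar>"
      have "\<bar>moment x y m\<bar> \<le> S"
        using osc[of "sin psi" "sin ?t" "- cos ?t"] by (simp add: moment_def S_def)
      moreover have "\<bar>weight x y m - mean x y\<bar> \<le> S"
        using osc[of "cos psi" "cos ?t" "sin ?t"] by (simp add: weight_def S_def)
      moreover have "2 * S < mean x y" using h by (simp add: S_def)
      ultimately show "\<bar>moment x y m\<bar> < weight x y m" by linarith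
    qed
  qed
  moreover have "0 < e" "e \<le> 1" using d(1) by (simp_all add: e_def)
  ultimately show thesis using that by blast
qed

lemma Suc_mod_neq: "Suc m mod n \<noteq> m mod n"
proof (cases "Suc (m mod n) = n")
  case True
  then have "m mod n \<noteq> 0" using three_sides by linarith
  then show ?thesis using True by (simp add: mod_Suc)
next
  case False
  then show ?thesis by (simp add: mod_Suc)
qed

text \<open>The two linear recurrences say that \<open>1 - r m\<close> and \<open>1 + r (Suc m)\<close> have the same
  numerator. It cancels in the reflection law, which reduces to the
  second-order recurrence for \<open>weight\<close>.\<close>

lemma billiard_orbit:
  assumes adm: "admissible x y"
  shows "billiard_orbit B (orbit x y)"
proof -
  define f where "f = weight x y"
  define g where "g = moment x y"
  define r where "r m = g m / f m" for m
  have less: "\<bar>g m\<bar> < f m" for m using adm by (simp add: admissible_def f_def g_def)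
  have f_pos: "0 < f m" for m using less[of m] by linarith
  have r: "\<bar>r m\<bar> < 1" for m using less[of m] f_pos[of m] by (simp add: r_def)
  have orbit: "orbit x y m = side_pt m (r m)" for m by (simp add: orbit_def r_def f_def g_def)
  have on_side: "orbit x y m \<in> side_interior B (m mod n)" for m
    using r[of m] by (auto simp: orbit billiard_sides side_pt_mod abs_less_iff)
  have mod_less: "m mod n < n" for m using three_sides by simp
  have chord: "orbit x y m \<noteq> orbit x y (Suc m)"
    "open_segment (orbit x y m) (orbit x y (Suc m)) \<subseteq> interior ngon" for m
  proof -
    have "nrm m \<bullet> side_pt (Suc m) (r (Suc m)) < cos a"
      using nrm_side_pt_less r Suc_mod_neq by blast
    then show "orbit x y m \<noteq> orbit x y (Suc m)"
      unfolding orbit using nrm_side_pt_self[of m "r m"] by force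
    show "open_segment (orbit x y m) (orbit x y (Suc m)) \<subseteq> interior ngon"
      unfolding orbit by (intro chord_in_interior r Suc_mod_neq[symmetric])
  qed
  have reflect: "proj_reflects (orbit x y (Suc m)) (side_line B (Suc m mod n))
      (pb_trans B (Suc m mod n) (orbit x y (Suc m)))
      (affine hull {orbit x y m, orbit x y (Suc m)})
      (affine hull {orbit x y (Suc m), orbit x y (Suc (Suc m))})" for m
  proof -
    let ?F = "f m" and ?G = "g m"
    define F1 where "F1 = f (Suc m)"
    define F2 where "F2 = f (Suc (Suc m))"
    define G1 where "G1 = g (Suc m)"
    define G2 where "G2 = g (Suc (Suc m))"
    have pos: "0 < ?F" "0 < F1" "0 < F2" using f_pos by (simp_all add: F1_def F2_def)
    have e: "F1 + G1 = ?F - ?G" "F2 + G2 = F1 - G1" "F2 = ?F - 4 * (cos psi)\<^sup>2 * G1"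
      using weight_moment_recurrences[of x y m] weight_moment_recurrences(1)[of x y "Suc m"]
      by (simp_all add: f_def g_def F1_def F2_def G1_def G2_def)
    define P where "P = ?F - ?G"
    define Q where "Q = F1 - G1"
    have q: "1 - r m = P / ?F" "1 + r (Suc m) = P / F1" "1 - r (Suc m) = Q / F1"
      "1 + r (Suc (Suc m)) = Q / F2" "r (Suc m) = G1 / F1"
      using pos e(1,2) by (simp_all add: r_def P_def Q_def F1_def F2_def G1_def G2_def field_simps)
    have "(Q / F1) * (P / ?F) - (P / F1) * (Q / F2) = P * Q * (F2 - ?F) / (?F * F1 * F2)"
      using pos by (simp add: field_simps)
    also have "F2 - ?F = - 4 * (cos psi)\<^sup>2 * G1" using e(3) by simp
    finally have "(1 - r (Suc m)) * (1 - r m) - (1 + r (Suc m)) * (1 + r (Suc (Suc m)))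
        = - 4 * (cos psi)\<^sup>2 * r (Suc m) * (1 + r (Suc (Suc m))) * (1 - r m)"
      unfolding q(1-4) unfolding q(5) by (simp add: mult_ac)
    moreover have "r m \<noteq> 1" "r (Suc (Suc m)) \<noteq> -1"
      using r[of m] r[of "Suc (Suc m)"] by auto
    ultimately have "proj_reflects (side_pt (Suc m) (r (Suc m)))
        (affine hull {vert n (Suc m), vert n (Suc (Suc m))})
        (affine hull {side_pt (Suc m) (r (Suc m)), centre n j (Suc m)})
        (affine hull {side_pt m (r m), side_pt (Suc m) (r (Suc m))})
        (affine hull {side_pt (Suc m) (r (Suc m)), side_pt (Suc (Suc m)) (r (Suc (Suc m)))})"
      by (intro reflection_at_side)
    moreover have "side_line B (Suc m mod n) = affine hull {vert n (Suc m), vert n (Suc (Suc m))}"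
      unfolding billiard_sides side_line_eq[of _ 0] side_pt_mod tng_mod ..
    moreover have "centre n j (Suc m mod n) = centre n j (Suc m)"
      unfolding centre_eq nrm_mod ..
    ultimately show ?thesis by (simp add: orbit billiard_fields)
  qed
  show ?thesis
    unfolding billiard_orbit_def billiard_fields(1,2)
    using on_side mod_less chord reflect by blast
qed

text \<open>The impact \<open>d\<close> is interior to side \<open>d\<close>, and so it is off the line of side \<open>0\<close>.\<close>

lemma orbit_leaves_start:
  assumes "admissible x y" "0 < d" "d < n"
  shows "orbit x y d \<noteq> orbit x y 0"
proof -
  have "\<bar>moment x y d\<bar> < weight x y d" using assms(1) by (simp add: admissible_def)
  then have "\<bar>moment x y d / weight x y d\<bar> < 1" by (simp add: field_simps)
  then have "nrm 0 \<bullet> orbit x y d < cos a"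
    unfolding orbit_def using assms(2,3) by (intro nrm_side_pt_less) auto
  moreover have "nrm 0 \<bullet> orbit x y 0 = cos a" by (simp add: orbit_def)
  ultimately show ?thesis by force
qed


section \<open>Reflectivity\<close>

text \<open>The strict inequalities for the other sides cut side \<open>k\<close> out of the boundary, and the
  bound on the tangential coordinate cuts out the patch.\<close>

lemma openin_side_patch:
  assumes "k < n" "0 < e" "e \<le> 1"
  shows "openin (top_of_set (frontier (pb_domain B))) (side_pt k ` {-e<..<e})"
proof -
  define W where "W = {p. \<bar>tng k \<bullet> p\<bar> < sin a * e} \<inter> (\<Inter>i\<in>{..<n} - {k}. {p. nrm i \<bullet> p < cos a})"
  have "open {p. \<bar>tng k \<bullet> p\<bar> < sin a * e}"
    by (intro open_Collect_less continuous_intros)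
  then have "open W"
    unfolding W_def by (intro open_Int open_INT ballI open_halfspace_lt) auto
  have tng: "tng k \<bullet> side_pt k x = sin a * x" for x
    by (simp add: side_pt_def inner_right_distrib)
  have "side_pt k ` {-e<..<e} = frontier (pb_domain B) \<inter> W"
  proof
    show "side_pt k ` {-e<..<e} \<subseteq> frontier (pb_domain B) \<inter> W"
    proof
      fix p assume "p \<in> side_pt k ` {-e<..<e}"
      then obtain x where p: "p = side_pt k x" and x: "\<bar>x\<bar> < e" by auto
      have "p \<in> side_pt k ` {-1..1}" using x assms(3) p by (intro image_eqI[of _ _ x]) auto
      then have "p \<in> frontier (pb_domain B)"
        unfolding billiard_fields frontier_interior_ngon using assms(1) by blast
      moreover have "\<bar>tng k \<bullet> p\<bar> < sin a * e"
        using x sin_pos by (simp add: p tng abs_mult)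
      moreover have "nrm i \<bullet> p < cos a" if "i < n" "i \<noteq> k" for i
        unfolding p using that x assms by (intro nrm_side_pt_less) auto
      ultimately show "p \<in> frontier (pb_domain B) \<inter> W" by (simp add: W_def)
    qed
  next
    show "frontier (pb_domain B) \<inter> W \<subseteq> side_pt k ` {-e<..<e}"
    proof
      fix p assume p: "p \<in> frontier (pb_domain B) \<inter> W"
      then obtain i x where i: "i < n" and px: "p = side_pt i x"
        unfolding billiard_fields frontier_interior_ngon by blast
      have "nrm i \<bullet> p = cos a" by (simp add: px)
      then have "i = k" using p i unfolding W_def by force
      then have "\<bar>sin a * x\<bar> < sin a * e" using p by (simp add: W_def px tng)
      then have "\<bar>x\<bar> < e" using sin_pos by (simp add: abs_mult)
      then show "p \<in> side_pt k ` {-e<..<e}" using px \<open>i = k\<close> by (auto simp: abs_less_iff)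
    qed
  qed
  then show ?thesis using \<open>open W\<close> by (metis openin_open)
qed

lemma reflective_primitive: "k_reflective B n" "k_reflective_primitive B n"
proof -
  obtain e where e: "0 < e" "e \<le> 1"
    and adm: "\<And>x y. \<bar>x\<bar> < e \<Longrightarrow> \<bar>y\<bar> < e \<Longrightarrow> admissible x y"
    using admissible_near_0 by blast
  define U where "U k = side_pt k ` {-e<..<e}" for k
  have start: "\<exists>x y. admissible x y \<and> orbit x y 0 = q1 \<and> orbit x y 1 = q2"
    if q: "q1 \<in> U 0" "q2 \<in> U 1" for q1 q2
  proof -
    have U: "\<exists>x. p = side_pt k x \<and> \<bar>x\<bar> < e" if "p \<in> U k" for p k
      using that by (force simp: U_def abs_less_iff)
    obtain x y where "q1 = side_pt 0 x" "\<bar>x\<bar> < e" "q2 = side_pt 1 y" "\<bar>y\<bar> < e"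
      using U[OF q(1)] U[OF q(2)] by blast
    then show ?thesis using adm orbit_initial[of x y] e by fastforce
  qed
  have per: "periodic_orbit n (orbit x y)" for x y
    using three_sides orbit_periodic[of x y 0] orbit_periodic[of x y 1]
    by (simp add: periodic_orbit_def)
  have all: "\<exists>q. billiard_orbit B q \<and> periodic_orbit n q \<and> q 0 = q1 \<and> q 1 = q2"
    if "q1 \<in> U 0" "q2 \<in> U 1" for q1 q2
    using start[OF that] billiard_orbit per by metis
  have mid: "side_pt 0 0 \<in> U 0" "side_pt 1 0 \<in> U 1" using e(1) by (auto simp: U_def)
  have refl: "reflective_on B n (U 0) (U 1)"
    unfolding reflective_on_def
  proof (intro conjI)
    show "openin (top_of_set (frontier (pb_domain B))) (U 0)"
      "openin (top_of_set (frontier (pb_domain B))) (U 1)"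
      unfolding U_def using three_sides e by (auto intro: openin_side_patch)
    show "\<exists>p. billiard_orbit B p \<and> periodic_orbit n p \<and> p 0 \<in> U 0 \<and> p 1 \<in> U 1"
      using all[OF mid] mid by metis
    show "\<forall>q1\<in>U 0. \<forall>q2\<in>U 1. \<exists>q. billiard_orbit B q \<and> periodic_orbit n q \<and> q 0 = q1 \<and> q 1 = q2"
      using all by blast
  qed
  then show "k_reflective B n" unfolding k_reflective_def by blast
  have "\<not> periodic_orbit d q" if q: "billiard_orbit B q" "q 0 \<in> U 0" "q 1 \<in> U 1" and "d < n" for q d
  proof
    assume d: "periodic_orbit d q"
    obtain x y where xy: "admissible x y" "orbit x y 0 = q 0" "orbit x y 1 = q 1"
      using start[OF q(2,3)] by blast
    have "convex (pb_domain B)"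
      unfolding billiard_fields by (rule convex_interior[OF convex_ngon])
    then have "orbit x y = q"
      using billiard_orbit_unique projective_billiard billiard_orbit[OF xy(1)] q(1) xy(2,3) by blast
    then show False
      using orbit_leaves_start[OF xy(1) _ \<open>d < n\<close>] d by (auto simp: periodic_orbit_def)
  qed
  then show "k_reflective_primitive B n"
    unfolding k_reflective_primitive_def using refl by blast
qed

end

theorem theorem4p6:
  fixes n j :: nat
  assumes "3 \<le> n" and "1 \<le> j" and "real j < real n / 2"
  shows "projective_billiard (regular_billiard n j) \<and>
         k_reflective (regular_billiard n j) n \<and>
         k_reflective_primitive (regular_billiard n j) n"
proof -
  interpret regular_pencils n j by unfold_locales (use assms in auto)
  show ?thesis using projective_billiard reflective_primitive by blast
qed

end
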